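(* If $M \in \mathbb{Z}^{6\times 6}$ is a proper Euler magic matrix of order $6$ with constant $\gamma$, then $\gamma \geq 2485$.
   Context: Let $n \geq 1$. A matrix $M = (m_{i,j})_{1\leq i,j\leq n} \in \mathbb{Z}^{n\times n}$ is an Euler magic matrix (of order $n$) with constant $\gamma \in \mathbb{Z}\setminus\{0\}$ if all of the following hold: (i) $M M^{t} = \gamma I_n$, where $M^t$ is the transpose of $M$ and $I_n$ is the $n\times n$ identity matrix; (ii) $\sum_{i=1}^{n} m_{i,i}^2 = \gamma$; (iii) $\sum_{i=1}^{n} m_{i,n+1-i}^2 = \gamma$. An Euler magic matrix is proper if the squares $m_{i,j}^2$ of its $n^2$ entries are pairwise distinct. *)

theory Defs
  imports "Jordan_Normal_Form.Matrix"
begin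

text \<open>Matrices are indexed from \<open>0\<close>, so the paper's antidiagonal entry
  \<open>(i, n + 1 - i)\<close> becomes \<open>(i, n - 1 - i)\<close>.\<close>

definition euler_magic :: "nat \<Rightarrow> int \<Rightarrow> int mat \<Rightarrow> bool" where
  "euler_magic n \<gamma> M \<longleftrightarrow>
     n \<ge> 1 \<and> \<gamma> \<noteq> 0 \<and> M \<in> carrier_mat n n \<and>
     M * M\<^sup>T = \<gamma> \<cdot>\<^sub>m 1\<^sub>m n \<and>
     (\<Sum>i<n. (M $$ (i, i))\<^sup>2) = \<gamma> \<and>
     (\<Sum>i<n. (M $$ (i, n - 1 - i))\<^sup>2) = \<gamma>"

definition proper_euler_magic :: "nat \<Rightarrow> int \<Rightarrow> int mat \<Rightarrow> bool" where
  "proper_euler_magic n \<gamma> M \<longleftrightarrow>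
     euler_magic n \<gamma> M \<and> inj_on (\<lambda>ij. (M $$ ij)\<^sup>2) ({..<n} \<times> {..<n})"

end

theory Submission
  imports Defs
begin

text \<open>The sum of all squared entries is \<open>6\<gamma>\<close>, while \<open>36\<close> distinct squares sum to at least
  \<open>0\<^sup>2 + 1\<^sup>2 + \<dots> + 35\<^sup>2 = 6 \<cdot> 2485\<close>.\<close>

text \<open>Induction that adds the largest element \<open>b\<close> last: the elements of
  \<open>A\<close> are distinct naturals below \<open>b\<close>, so \<open>card A \<le> b\<close>,
  and by monotonicity the new term \<open>f (card A)\<close> on the left is at most the new term
  \<open>f b\<close> on the right.\<close>

lemma sum_lessThan_card_le_sum:
  fixes f :: "nat \<Rightarrow> 'a::ordered_comm_monoid_add"
  assumes "mono f" "finite A"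
  shows "(\<Sum>k<card A. f k) \<le> sum f A"
  using assms(2)
proof (induction A rule: finite_linorder_max_induct)
  case empty
  then show ?case by simp
next
  case (insert b A)
  have "A \<subseteq> {..<b}"
    using insert.hyps by auto
  then have "card A \<le> b"
    using card_mono[of "{..<b}" A] by simp
  then have "f (card A) \<le> f b"
    using \<open>mono f\<close> by (simp add: monoD)
  moreover have "b \<notin> A"
    using insert.hyps by auto
  ultimately show ?case
    using insert by (simp add: add.commute add_mono)
qed

lemma sum_squares_lessThan_card_le:
  fixes g :: "'a \<Rightarrow> int"
  assumes "finite S" "inj_on (\<lambda>x. (g x)\<^sup>2) S"
  shows "(\<Sum>k<card S. (int k)\<^sup>2) \<le> (\<Sum>x\<in>S. (g x)\<^sup>2)"
proof -
  define h where "h x = nat \<bar>g x\<bar>" for x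
  have h: "(int (h x))\<^sup>2 = (g x)\<^sup>2" for x
    by (simp add: h_def)
  have inj: "inj_on h S"
    using assms(2) by (metis h inj_on_def)
  have "mono (\<lambda>k. (int k)\<^sup>2)"
    by (simp add: mono_def power_mono)
  then have "(\<Sum>k<card (h ` S). (int k)\<^sup>2) \<le> (\<Sum>k\<in>h ` S. (int k)\<^sup>2)"
    using assms(1) by (intro sum_lessThan_card_le_sum) auto
  \<comment> \<open>Injectivity of \<open>h\<close> serves twice: the image has
    \<open>card S\<close> elements, and the sum over it reindexes to a sum over
    \<open>S\<close>.\<close>
  then show ?thesis
    using inj by (simp add: card_image sum.reindex h)
qed

text \<open>Diagonal entries of \<open>M * M\<^sup>T\<close> are scalar products of rows with
  themselves.\<close>

lemma euler_magic_row_sum: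
  assumes "euler_magic n \<gamma> M" "i < n"
  shows "(\<Sum>j<n. (M $$ (i, j))\<^sup>2) = \<gamma>"
proof -
  have M: "M \<in> carrier_mat n n" and eq: "M * M\<^sup>T = \<gamma> \<cdot>\<^sub>m 1\<^sub>m n"
    using assms(1) by (auto simp: euler_magic_def)
  have "(M * M\<^sup>T) $$ (i, i) = (\<Sum>j<n. (M $$ (i, j))\<^sup>2)"
    using M assms(2) by (auto simp: scalar_prod_def power2_eq_square atLeast0LessThan)
  moreover have "(M * M\<^sup>T) $$ (i, i) = \<gamma>"
    using assms(2) by (simp add: eq)
  ultimately show ?thesis by simp
qed

theorem proposition3p1:
  fixes M :: "int mat" and \<gamma> :: int
  assumes "proper_euler_magic 6 \<gamma> M"
  shows "\<gamma> \<ge> 2485"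
proof -
  let ?S = "{..<6::nat} \<times> {..<6::nat}"
  have magic: "euler_magic 6 \<gamma> M" and inj: "inj_on (\<lambda>ij. (M $$ ij)\<^sup>2) ?S"
    using assms by (auto simp: proper_euler_magic_def)
  have "(\<Sum>k<36. (int k)\<^sup>2) \<le> (\<Sum>ij\<in>?S. (M $$ ij)\<^sup>2)"
    using sum_squares_lessThan_card_le[OF _ inj] by simp
  also have "\<dots> = (\<Sum>i<6. \<Sum>j<6. (M $$ (i, j))\<^sup>2)"
    by (simp add: sum.cartesian_product)
  also have "\<dots> = 6 * \<gamma>"
    using euler_magic_row_sum[OF magic] by simp
  also have "(\<Sum>k<36. (int k)\<^sup>2) = 14910"
    by (simp add: lessThan_nat_numeral lessThan_Suc)
  finally show ?thesis by simp
qed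

end
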